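(* Let $K$ be a field of characteristic zero and let $p(x, y)\in K[x, y]$ be a nonzero polynomial such that the generating function $$F_p(x, y) := \sum_{\substack{(n, m)\in \mathbb{N}^2 \\ p(n, m)=0}} x^ny^m$$ is rational. Then $p = c\cdot f\cdot g$, where $c\in K$ is a constant, $f$ is a product of linear polynomials in $x$ and $y$ with integer coefficients, and $g\in K[x,y]$ has only finitely many zeros in $\mathbb{N}^2$.
   Context: $\mathbb{N}$ denotes the set of nonnegative integers, viewed inside $K$. $F_p$ is rational if $F_p=P/Q$ for polynomials $P,Q\in K[x,y]$ with $Q\neq 0$. *)

theory Defs
  imports "HOL-Computational_Algebra.Computational_Algebra"
begin

text \<open>
  The ring \<open>K[x,y]\<close> is rendered as \<open>K[x][y]\<close>, i.e. as the type \<open>'a poly poly\<close>: the outer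
  variable is \<open>y\<close>, the inner one is \<open>x\<close>. Likewise \<open>K[[x,y]]\<close> is \<open>'a fps fps\<close>, i.e.
  \<open>K[[x]][[y]]\<close>, so that the coefficient of \<open>x^n y^m\<close> is the \<open>n\<close>-th coefficient of the \<open>m\<close>-th one.
\<close>

definition bX :: "'a::comm_ring_1 poly poly" where
  "bX = [:[:0, 1:]:]"

definition bY :: "'a::comm_ring_1 poly poly" where
  "bY = [:0, 1:]"

definition bconst :: "'a::comm_ring_1 \<Rightarrow> 'a poly poly" where
  "bconst c = [:[:c:]:]"

definition beval :: "'a::comm_ring_1 poly poly \<Rightarrow> 'a \<Rightarrow> 'a \<Rightarrow> 'a" where
  "beval p u v = poly (poly p [:v:]) u"

definition nat_zeros :: "'a::comm_ring_1 poly poly \<Rightarrow> (nat \<times> nat) set" where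
  "nat_zeros p = {(n, m). beval p (of_nat n) (of_nat m) = 0}"

definition gen_fun :: "'a::comm_ring_1 poly poly \<Rightarrow> 'a fps fps" where
  "gen_fun p = Abs_fps (\<lambda>m. Abs_fps (\<lambda>n. if (n, m) \<in> nat_zeros p then 1 else 0))"

definition fps_of_bpoly :: "'a::comm_ring_1 poly poly \<Rightarrow> 'a fps fps" where
  "fps_of_bpoly P = fps_of_poly (map_poly fps_of_poly P)"

text \<open>
  The equation \<open>F = P / Q\<close> is read in the fraction field of \<open>K[[x,y]]\<close>, which contains both
  \<open>K[[x,y]]\<close> and \<open>K(x,y)\<close>; \<open>rational_fps2_iff\<close> below clears the denominator.
\<close>

definition rational_fps2 :: "'a::field fps fps \<Rightarrow> bool" where
  "rational_fps2 F \<longleftrightarrow>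
     (\<exists>P Q. Q \<noteq> 0 \<and> to_fract F = Fract (fps_of_bpoly P) (fps_of_bpoly Q))"

text \<open>``Linear'' means of total degree exactly one; nonzero constants are not linear.\<close>

definition int_linear :: "'a::comm_ring_1 poly poly \<Rightarrow> bool" where
  "int_linear l \<longleftrightarrow>
     (\<exists>a b c :: int. (a, b) \<noteq> (0, 0) \<and> l = of_int a * bX + of_int b * bY + of_int c)"

lemma beval_simps [simp]:
  "beval bX u v = u" "beval bY u v = v" "beval (bconst c) u v = c"
  "beval (p + q) u v = beval p u v + beval q u v"
  "beval (p * q) u v = beval p u v * beval q u v"
  by (simp_all add: beval_def bX_def bY_def bconst_def)

lemma gen_fun_nth:
  "fps_nth (fps_nth (gen_fun p) m) n = (if beval p (of_nat n) (of_nat m) = 0 then 1 else 0)"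
  by (simp add: gen_fun_def nat_zeros_def)

lemma fps_of_bpoly_nth: "fps_nth (fps_nth (fps_of_bpoly P) m) n = coeff (coeff P m) n"
  by (simp add: fps_of_bpoly_def coeff_map_poly)

lemma fps_of_bpoly_eq_0_iff [simp]: "fps_of_bpoly P = 0 \<longleftrightarrow> P = 0"
  by (auto simp: fps_eq_iff poly_eq_iff fps_of_bpoly_nth)

lemma rational_fps2_iff:
  "rational_fps2 F \<longleftrightarrow> (\<exists>P Q. Q \<noteq> 0 \<and> F * fps_of_bpoly Q = fps_of_bpoly P)"
proof -
  have "to_fract F = Fract (fps_of_bpoly P) (fps_of_bpoly Q) \<longleftrightarrow> F * fps_of_bpoly Q = fps_of_bpoly P"
    if "Q \<noteq> 0" for P Q :: "'a poly poly"
    using that by (simp add: to_fract_def eq_fract)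
  then show ?thesis
    unfolding rational_fps2_def by blast
qed

end

theory Submission
  imports Defs "Berlekamp_Zassenhaus.Unique_Factorization_Poly"
begin

text \<open>
  Write \<open>F\<^sub>p * Q = P\<close> and let \<open>s\<close> be the lexicographically largest exponent of \<open>Q\<close>. Comparing
  coefficients at \<open>z + s\<close> shows that every zero \<open>z\<close> of \<open>p\<close> outside a finite set has another zero
  \<open>z + d\<close>, with \<open>d\<close> from a fixed finite set of lexicographically positive vectors. If an
  irreducible factor \<open>h\<close> of \<open>p\<close> has infinitely many zeros in \<open>\<nat>\<^sup>2\<close>, the pigeonhole principle
  gives one \<open>d\<close> and one irreducible factor \<open>h'\<close> of \<open>p\<close> such that \<open>h\<close> and \<open>h'(\<cdot> + d)\<close> have
  infinitely many common zeros, so \<open>h\<close> divides \<open>h'(\<cdot> + d)\<close>; moreover \<open>h'\<close> is not a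
  constant multiple of an integer linear polynomial unless \<open>h\<close> is. Since there are finitely many
  factors, iterating returns to some factor, whose zero set is then mapped into itself by a nonzero
  integer translation; it vanishes at infinitely many points of a line with integer coefficients,
  hence is that line up to a constant.
\<close>

section \<open>Evaluation, units and divisors\<close>

lemma beval_more [simp]:
  "beval 0 u v = 0" "beval 1 u v = 1" "beval (of_int k) u v = of_int k"
  "beval (pCons c h) u v = poly c u + v * beval h u v"
  "beval (smult c h) u v = poly c u * beval h u v"
  by (simp_all add: beval_def of_int_poly)

lemma beval_dvd: "beval g u v = 0 \<Longrightarrow> g dvd h \<Longrightarrow> beval h u v = 0"
  by (auto elim!: dvdE)

lemma is_unit_imp_beval_nonzero:
  assumes "is_unit g"
  shows "beval g u v \<noteq> 0"
proof -
  obtain k where "1 = g * k" using assms by (elim dvdE)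
  then have "beval g u v * beval k u v = 1" by (metis beval_simps(5) beval_more(2))
  then show ?thesis by auto
qed

text \<open>The cofactor of \<open>l\<close> in \<open>h\<close> is a unit, and units have no
  zeros.\<close>

lemma beval_eq_0_if_dvd_irreducible:
  assumes "irreducible h" "l dvd h" "\<not> is_unit l" "beval h u v = 0"
  shows "beval l u v = 0"
proof -
  obtain k where k: "h = l * k" using assms(2) by (elim dvdE)
  then have "is_unit k" using assms(1,3) irreducibleD by blast
  then show ?thesis using k assms(4) is_unit_imp_beval_nonzero[of k u v] by auto
qed

section \<open>Divisibility from infinitely many common zeros\<close>

definition restrict_x :: "'a::comm_ring_1 \<Rightarrow> 'a poly poly \<Rightarrow> 'a poly" where
  "restrict_x u h = map_poly (\<lambda>c. poly c u) h"

lemma poly_restrict_x: "poly (restrict_x u h) v = beval h u v"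
  unfolding restrict_x_def by (induction h) (simp_all add: map_poly_pCons)

text \<open>Setting \<open>x = u\<close> leaves a polynomial in \<open>y\<close> with infinitely
  many roots, hence 0; so every coefficient in \<open>K[x]\<close> is divisible by
  \<open>x - u\<close>.\<close>

lemma vertical_line_dvd:
  fixes h :: "'a::field poly poly"
  assumes "infinite {v. beval h u v = 0}"
  shows "[:[:-u, 1:]:] dvd h"
proof -
  have "restrict_x u h = 0"
    using assms poly_roots_finite[of "restrict_x u h"] by (auto simp: poly_restrict_x)
  then have "poly (coeff h n) u = 0" for n
    by (metis restrict_x_def coeff_map_poly poly_0 coeff_0)
  then show ?thesis
    by (simp add: const_poly_dvd_iff poly_eq_0_iff_dvd)
qed

lemma const_dvd_imp_degree_0:
  fixes h :: "'a::idom poly"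
  assumes "h dvd [:c:] ^ k" "c \<noteq> 0"
  shows "degree h = 0"
proof -
  have "degree h \<le> degree ([:c:] ^ k)" using assms by (intro dvd_imp_degree_le) auto
  then show ?thesis using degree_power_le[of "[:c:]" k] by simp
qed

text \<open>A nonzero combination of least \<open>y\<close>-degree divides both \<open>h\<close> and \<open>q\<close> up to a factor from
  \<open>K[x]\<close>, by pseudo-division.\<close>

lemma irreducible_not_dvd_imp_elimination:
  fixes h q :: "'a::ufd poly"
  assumes h: "irreducible h" and nd: "\<not> h dvd q" and deg: "degree h \<noteq> 0"
  obtains A B r where "r \<noteq> 0" "A * h + B * q = [:r:]"
proof -
  \<comment> \<open>The nonzero elements of the ideal generated by \<open>h\<close> and
    \<open>q\<close>; one of least degree acts as a gcd over the fraction field of the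
    coefficients.\<close>
  define I where "I = {w. w \<noteq> 0 \<and> (\<exists>A B. w = A * h + B * q)}"
  have "h = 1 * h + 0 * q" by simp
  then have "h \<in> I" using h unfolding I_def by blast
  then obtain w where w: "w \<in> I" and wmin: "\<And>w'. w' \<in> I \<Longrightarrow> degree w \<le> degree w'"
    using ex_has_least_nat[of "\<lambda>w. w \<in> I" h degree] by blast
  then have w0: "w \<noteq> 0" by (auto simp: I_def)
  obtain A B where AB: "w = A * h + B * q" using w by (auto simp: I_def)
  \<comment> \<open>The pseudo-remainder lies in the ideal and is zero or of smaller degree than
    \<open>w\<close>, so minimality makes it zero.\<close>
  have dvd: "\<exists>n. w dvd [:lead_coeff w:] ^ n * f" if f: "f = A' * h + B' * q" for f A' B'
  proof -
    obtain s t where st: "pseudo_divmod f w = (s, t)" by fastforce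
    define c where "c = lead_coeff w ^ (Suc (degree f) - degree w)"
    note pd = pseudo_divmod[OF w0 st, folded c_def]
    have "t = smult c f - w * s" using pd(1) by simp
    also have "\<dots> = (smult c A' - A * s) * h + (smult c B' - B * s) * q"
      by (simp add: f AB algebra_simps smult_add_right)
    finally have "t = 0" using pd(2) wmin[of t] by (force simp: I_def)
    then have "w dvd smult c f" using pd(1) by simp
    moreover have "smult c f = [:lead_coeff w:] ^ (Suc (degree f) - degree w) * f"
      by (simp add: c_def poly_const_pow)
    ultimately show ?thesis by metis
  qed
  have prime: "prime_elem h" using h by simp
  have lw: "lead_coeff w \<noteq> 0" using w0 by simp
  have "degree w = 0"
  proof -
    obtain n s where s: "[:lead_coeff w:] ^ n * h = w * s"
      using dvd[of h 1 0] by (auto elim!: dvdE)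
    obtain m where t: "w dvd [:lead_coeff w:] ^ m * q"
      using dvd[of q 0 1] by auto
    \<comment> \<open>If the prime \<open>h\<close> divides \<open>w\<close>, it divides a constant,
      as it does not divide \<open>q\<close>; if it divides \<open>s\<close>, cancelling
      \<open>h\<close> shows that \<open>w\<close> divides a constant.\<close>
    have "h dvd w * s" using s by (metis dvd_triv_right)
    then consider "h dvd w" | "h dvd s" unfolding prime_elem_dvd_mult_iff[OF prime] by fast
    then show ?thesis
    proof cases
      case 1
      then have "h dvd [:lead_coeff w:] ^ m * q" using t dvd_trans by blast
      then have "h dvd [:lead_coeff w:] ^ m"
        using nd unfolding prime_elem_dvd_mult_iff[OF prime] by simp
      then show ?thesis using const_dvd_imp_degree_0[OF _ lw] deg by simp
    next
      case 2
      then obtain s' where "s = h * s'" by (elim dvdE)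
      then have "[:lead_coeff w:] ^ n = w * s'" using s h by (auto simp: algebra_simps)
      then have "w dvd [:lead_coeff w:] ^ n" by simp
      then show ?thesis by (rule const_dvd_imp_degree_0[OF _ lw])
    qed
  qed
  then obtain r where "w = [:r:]" by (rule degree_eq_zeroE)
  then show ?thesis using that[of r A B] AB w0 by auto
qed

text \<open>Otherwise eliminating \<open>y\<close> yields a nonzero \<open>r\<close> in
  \<open>K[x]\<close> that vanishes at the \<open>x\<close>-coordinates of all common zeros. As
  \<open>r\<close> has finitely many roots, infinitely many common zeros lie on one vertical line,
  which divides both polynomials and is associated to \<open>h\<close>.\<close>

lemma irreducible_dvd_if_infinite_common_zeros:
  fixes h q :: "'a::field poly poly"
  assumes h: "irreducible h" and inf: "infinite {(u, v). beval h u v = 0 \<and> beval q u v = 0}"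
      (is "infinite ?S")
  shows "h dvd q"
proof (rule ccontr)
  assume nd: "\<not> h dvd q"
  have "\<exists>r. r \<noteq> 0 \<and> (\<forall>(u, v) \<in> ?S. poly r u = 0)"
  proof (cases "degree h = 0")
    case True
    then obtain r where "h = [:r:]" by (rule degree_eq_zeroE)
    then show ?thesis using h by (intro exI[of _ r]) auto
  next
    case False
    then obtain A B r where r: "r \<noteq> 0" "A * h + B * q = [:r:]"
      using irreducible_not_dvd_imp_elimination[OF h nd] by metis
    have "poly r u = 0" if "(u, v) \<in> ?S" for u v
    proof -
      have "poly r u = beval [:r:] u v" by simp
      also have "\<dots> = 0" unfolding r(2)[symmetric] using that by simp
      finally show ?thesis .
    qed
    then show ?thesis using r(1) by auto
  qed
  then obtain r where r: "r \<noteq> 0" "\<And>u v. (u, v) \<in> ?S \<Longrightarrow> poly r u = 0" by blast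
  have "\<exists>u \<in> {u. poly r u = 0}. infinite {z \<in> ?S. fst z = u}"
    using r by (intro pigeonhole_infinite_rel inf poly_roots_finite) auto
  then obtain u where u: "infinite {z \<in> ?S. fst z = u}" by auto
  have "infinite {v. beval h u v = 0 \<and> beval q u v = 0}" (is "infinite ?V")
  proof
    assume "finite ?V"
    then have "finite (Pair u ` ?V)" by simp
    moreover have "{z \<in> ?S. fst z = u} \<subseteq> Pair u ` ?V" by auto
    ultimately show False using u finite_subset by blast
  qed
  then have "infinite {v. beval h u v = 0}" "infinite {v. beval q u v = 0}"
    by (auto elim!: contrapos_nn intro: rev_finite_subset)
  then have *: "[:[:-u, 1:]:] dvd h" "[:[:-u, 1:]:] dvd q"
    by (blast intro: vertical_line_dvd)+
  have "\<not> is_unit [:[:-u, 1:]:]" by (auto simp: is_unit_poly_iff)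
  then have "h dvd [:[:-u, 1:]:]" using irreducibleD'[OF h *(1)] by blast
  then show False using *(2) nd dvd_trans by blast
qed

section \<open>Translations and integer linear polynomials\<close>

definition shift :: "'a::comm_ring_1 \<Rightarrow> 'a \<Rightarrow> 'a poly poly \<Rightarrow> 'a poly poly" where
  "shift a b h = pcompose (map_poly (\<lambda>c. pcompose c [:a, 1:]) h) [:[:b:], 1:]"

lemma beval_shift: "beval (shift a b h) u v = beval h (u + a) (v + b)"
  unfolding shift_def
proof (induction h)
  case (pCons c h)
  then show ?case
    by (simp add: map_poly_pCons pcompose_pCons poly_pcompose algebra_simps)
qed simp

lemma int_linear_iff:
  fixes l :: "'a::comm_ring_1 poly poly"
  shows "int_linear l \<longleftrightarrow> (\<exists>a b c :: int. (a, b) \<noteq> (0, 0) \<and> l = [:[:of_int c, of_int a:], [:of_int b:]:])"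
proof -
  have "of_int a * bX + of_int b * bY + of_int c = [:[:of_int c, of_int a:], [:of_int b :: 'a:]:]"
    for a b c :: int
    by (simp add: bX_def bY_def of_int_poly)
  then show ?thesis unfolding int_linear_def by simp
qed

lemma beval_linear: "beval [:[:c, a:], [:b:]:] u v = a * u + b * v + c"
  by (simp add: algebra_simps)

text \<open>The degrees of two factors add up to 1, and a factor of degree 0 divides the unit
  \<open>b\<close>.\<close>

lemma irreducible_degree_1:
  fixes b :: "'a::{idom_divide,algebraic_semidom}"
  assumes "is_unit b"
  shows "irreducible [:c, b:]"
proof (rule irreducibleI)
  have b: "b \<noteq> 0" using assms by auto
  show "[:c, b:] \<noteq> 0" using b by simp
  show "\<not> is_unit [:c, b:]" using b by (auto simp: is_unit_poly_iff)
  fix f g assume fg: "[:c, b:] = f * g"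
  have aux: "is_unit s" if st: "[:c, b:] = s * t" and s: "degree s = 0" for s t
  proof -
    obtain s0 where s0: "s = [:s0:]" using s by (rule degree_eq_zeroE)
    then have "b = s0 * coeff t 1" using arg_cong[OF st, of "\<lambda>w. coeff w 1"] by simp
    then have "is_unit s0" using assms by (metis dvd_trans dvd_triv_left)
    then show ?thesis using s0 by simp
  qed
  have "f \<noteq> 0" "g \<noteq> 0" using fg b by auto
  then have "degree f + degree g = 1" using arg_cong[OF fg, of degree] b by (simp add: degree_mult_eq)
  then consider "degree f = 0" | "degree g = 0" by linarith
  then show "is_unit f \<or> is_unit g" using aux fg by cases (metis mult.commute)+
qed

text \<open>Characteristic zero keeps nonzero integers invertible in \<open>K\<close>, so
  \<open>l\<close> is linear in \<open>x\<close> alone or linear in \<open>y\<close> with a unit as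
  leading coefficient.\<close>

lemma int_linear_irreducible:
  fixes l :: "'a::field_char_0 poly poly"
  assumes "int_linear l"
  shows "irreducible l"
proof -
  obtain a b c :: int where ab: "(a, b) \<noteq> (0, 0)" and l: "l = [:[:of_int c, of_int a:], [:of_int b:]:]"
    using assms by (auto simp: int_linear_iff)
  show ?thesis
  proof (cases "b = 0")
    case True
    then show ?thesis
      using ab by (auto simp: l irreducible_const_poly_iff intro: irreducible_linear_field_poly)
  next
    case False
    then show ?thesis unfolding l by (intro irreducible_degree_1) (simp add: is_unit_pCons_iff)
  qed
qed

section \<open>Zeros forced by rationality\<close>

text \<open>The \<open>y\<close>-coordinate counts first, matching the choice of the top exponent of
  \<open>Q\<close> by its \<open>y\<close>-degree.\<close>

definition lex_pos :: "int \<Rightarrow> int \<Rightarrow> bool" where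
  "lex_pos a b \<longleftrightarrow> b > 0 \<or> b = 0 \<and> a > 0"

lemma lex_pos_add: "lex_pos a b \<Longrightarrow> lex_pos a' b' \<Longrightarrow> lex_pos (a + a') (b + b')"
  by (auto simp: lex_pos_def)

lemma bpoly_degree_bound:
  obtains C where "\<And>n m. C \<le> n \<or> C \<le> m \<Longrightarrow> coeff (coeff P m) n = 0"
proof -
  define C where "C = Suc (degree P + (\<Sum>m\<le>degree P. degree (coeff P m)))"
  have "coeff (coeff P m) n = 0" if "C \<le> n \<or> C \<le> m" for n m
  proof (cases "m \<le> degree P")
    case True
    then have "degree (coeff P m) \<le> (\<Sum>m\<le>degree P. degree (coeff P m))"
      by (intro member_le_sum) auto
    then show ?thesis using that True by (intro coeff_eq_0) (auto simp: C_def)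
  next
    case False
    then show ?thesis by (simp add: coeff_eq_0)
  qed
  then show ?thesis by (rule that)
qed

lemma rational_gen_fun_imp_successor:
  fixes p :: "'a::field poly poly"
  assumes "rational_fps2 (gen_fun p)"
  shows "\<exists>D C. finite D \<and> (\<forall>(a, b) \<in> D. lex_pos a b) \<and>
    (\<forall>(n, m) \<in> nat_zeros p. C \<le> n \<or> C \<le> m \<longrightarrow>
       (\<exists>(a, b) \<in> D. \<exists>(i, j) \<in> nat_zeros p. int i = int n + a \<and> int j = int m + b))"
proof -
  obtain P Q where Q0: "Q \<noteq> 0" and FQ: "gen_fun p * fps_of_bpoly Q = fps_of_bpoly P"
    using assms by (auto simp: rational_fps2_iff)
  obtain C where C: "\<And>n m. C \<le> n \<or> C \<le> m \<Longrightarrow> coeff (coeff P m) n = 0"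
    using bpoly_degree_bound[of P] by metis
  obtain B where B: "\<And>n m. B \<le> n \<or> B \<le> m \<Longrightarrow> coeff (coeff Q m) n = 0"
    using bpoly_degree_bound[of Q] by metis
  define t where "t = degree Q"
  define s where "s = degree (lead_coeff Q)"
  have top: "coeff (coeff Q t) s \<noteq> 0"
    using Q0 by (simp add: t_def s_def)
  \<comment> \<open>A finite box containing the differences between the top exponent
    \<open>(s, t)\<close> and all exponents of \<open>Q\<close>.\<close>
  define D where "D = {(a, b). lex_pos a b} \<inter> ({- int B..int s} \<times> {0..int t})"
  have step: "\<exists>(a, b) \<in> D. \<exists>(i, j) \<in> nat_zeros p. int i = int n + a \<and> int j = int m + b"
    if z: "(n, m) \<in> nat_zeros p" and far: "C \<le> n \<or> C \<le> m" for n m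
  proof (rule ccontr)
    assume none: "\<not> ?thesis"
    let ?a = "\<lambda>i j. if (i, j) \<in> nat_zeros p then 1 else (0::'a)"
    let ?q = "\<lambda>i j. coeff (coeff Q (m + t - j)) (n + s - i)"
    \<comment> \<open>A nonzero term needs \<open>(n + s - i, m + t - j)\<close> to be an exponent
      of \<open>Q\<close>, hence at most \<open>(s, t)\<close>; then \<open>(i, j)\<close> is a zero
      of \<open>p\<close> above \<open>(n, m)\<close> with difference in \<open>D\<close>, contrary
      to \<open>none\<close>.\<close>
    have vanish: "?a i j * ?q i j = 0" if "(i, j) \<noteq> (n, m)" "i \<le> n + s" "j \<le> m + t" for i j
    proof (rule ccontr)
      assume "\<not> ?thesis"
      then have ij: "(i, j) \<in> nat_zeros p" and q: "?q i j \<noteq> 0" by (auto split: if_splits)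
      have "m + t - j \<le> t"
        using q by (metis t_def le_degree coeff_0)
      then have j: "m \<le> j" using that by linarith
      have i: "n < i" if "j = m"
      proof -
        have "n + s - i \<le> s" using q that by (simp add: s_def t_def le_degree)
        then have "n \<le> i" using \<open>i \<le> n + s\<close> by linarith
        moreover have "n \<noteq> i" using \<open>(i, j) \<noteq> (n, m)\<close> that by auto
        ultimately show ?thesis by simp
      qed
      have "n + s - i < B" using B q by (meson not_le)
      then have "(int i - int n, int j - int m) \<in> D"
        using i j that by (auto simp: D_def lex_pos_def)
      then show False using none ij by force
    qed
    \<comment> \<open>The single surviving term is the top coefficient of \<open>Q\<close>, but
      \<open>P\<close> has no nonzero coefficient this far out.\<close>
    have "coeff (coeff P (m + t)) (n + s) =
        fps_nth (fps_nth (gen_fun p * fps_of_bpoly Q) (m + t)) (n + s)"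
      by (simp add: FQ fps_of_bpoly_nth)
    also have "\<dots> = (\<Sum>j=0..m + t. \<Sum>i=0..n + s. ?a i j * ?q i j)"
      by (simp add: fps_mult_nth fps_sum_nth fps_of_bpoly_nth gen_fun_def)
    also have "\<dots> = (\<Sum>(j, i)\<in>{0..m + t} \<times> {0..n + s}. ?a i j * ?q i j)"
      by (simp add: sum.cartesian_product)
    also have "\<dots> = (\<Sum>(j, i)\<in>{(m, n)}. ?a i j * ?q i j)"
      by (rule sum.mono_neutral_right) (use vanish in \<open>force+\<close>)
    also have "\<dots> = coeff (coeff Q t) s" using z by simp
    finally show False using top C[of "n + s" "m + t"] far by auto
  qed
  show ?thesis
    by (intro exI[of _ D] exI[of _ C]) (use step in \<open>auto simp: D_def\<close>)
qed

section \<open>Translations between irreducible factors\<close>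

text \<open>Zeros over all of \<open>K\<close> are meant, so that compositions and iterates may
  leave the quadrant of natural numbers.\<close>

definition translates_into ::
    "'a::comm_ring_1 poly poly \<Rightarrow> int \<Rightarrow> int \<Rightarrow> 'a poly poly \<Rightarrow> bool" where
  "translates_into h a b h' \<longleftrightarrow>
     (\<forall>u v. beval h u v = 0 \<longrightarrow> beval h' (u + of_int a) (v + of_int b) = 0)"

lemma translates_into_trans:
  assumes "translates_into h a b h'" "translates_into h' c d h''"
  shows "translates_into h (a + c) (b + d) h''"
proof -
  have "u + of_int (a + c) = (u + of_int a) + of_int c" for a c and u :: 'a
    by (simp add: algebra_simps)
  then show ?thesis using assms unfolding translates_into_def by metis
qed

lemma infinite_nat_zeros_imp_infinite_zeros:
  fixes h q :: "'a::field_char_0 poly poly"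
  assumes "infinite {(n, m). (n, m) \<in> nat_zeros h \<and> beval q (of_nat n) (of_nat m) = 0}"
    (is "infinite ?Z")
  shows "infinite {(u, v). beval h u v = 0 \<and> beval q u v = 0}" (is "infinite ?S")
proof -
  let ?f = "map_prod of_nat of_nat :: nat \<times> nat \<Rightarrow> 'a \<times> 'a"
  have "inj_on ?f ?Z" by (rule inj_on_subset[of _ UNIV]) (auto simp: inj_def)
  moreover have "?f ` ?Z \<subseteq> ?S" by (auto simp: nat_zeros_def)
  ultimately show ?thesis using assms by (meson finite_imageD finite_subset)
qed

lemma self_translate_imp_int_linear_dvd:
  fixes h :: "'a::field_char_0 poly poly"
  assumes self: "translates_into h a b h" and ab: "(a, b) \<noteq> (0, 0)" and z: "(n, m) \<in> nat_zeros h"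
  shows "\<exists>l. int_linear l \<and> l dvd h"
proof -
  \<comment> \<open>The line through \<open>(n, m)\<close> in direction \<open>(a, b)\<close>; it
    contains the whole orbit \<open>f\<close> of \<open>(n, m)\<close>.\<close>
  define l :: "'a poly poly"
    where "l = [:[:of_int (a * int m - b * int n), of_int b:], [:of_int (- a):]:]"
  have l: "int_linear l"
    unfolding int_linear_iff l_def using ab
    by (intro exI[of _ b] exI[of _ "- a"] exI[of _ "a * int m - b * int n"]) auto
  define f :: "nat \<Rightarrow> 'a \<times> 'a"
    where "f k = (of_nat n + of_nat k * of_int a, of_nat m + of_nat k * of_int b)" for k
  have "inj f" using ab by (auto simp: f_def inj_def)
  have "beval h (fst (f k)) (snd (f k)) = 0" for k
  proof (induction k)
    case 0
    then show ?case using z by (simp add: f_def nat_zeros_def)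
  next
    case (Suc k)
    then have "beval h (fst (f k) + of_int a) (snd (f k) + of_int b) = 0"
      using self unfolding translates_into_def by blast
    then show ?case by (simp add: f_def algebra_simps)
  qed
  moreover have "beval l (fst (f k)) (snd (f k)) = 0" for k
    by (simp add: l_def f_def beval_linear algebra_simps)
  ultimately have "range f \<subseteq> {(u, v). beval l u v = 0 \<and> beval h u v = 0}"
    by (intro image_subsetI) (simp add: case_prod_beta)
  then have "infinite {(u, v). beval l u v = 0 \<and> beval h u v = 0}"
    using \<open>inj f\<close> finite_subset range_inj_infinite by blast
  then show ?thesis
    using irreducible_dvd_if_infinite_common_zeros l int_linear_irreducible by blast
qed

lemma int_linear_shift:
  assumes "int_linear l"
  shows "\<exists>l'. int_linear l' \<and>
    (\<forall>u v. beval l' u v = beval l (u + of_int d) (v + of_int e))"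
proof -
  obtain a b c :: int where ab: "(a, b) \<noteq> (0, 0)" and l: "l = [:[:of_int c, of_int a:], [:of_int b:]:]"
    using assms by (auto simp: int_linear_iff)
  have "int_linear [:[:of_int (c + a * d + b * e), of_int a:], [:of_int b :: 'a:]:]"
    using ab unfolding int_linear_iff by blast
  then show ?thesis
    by (intro exI conjI) (auto simp: l algebra_simps)
qed

lemma exists_successor_factor:
  fixes p :: "'a::field_char_0 poly poly"
  assumes rat: "rational_fps2 (gen_fun p)" and p: "p = prod_mset F"
    and irr: "\<And>h. h \<in># F \<Longrightarrow> irreducible h"
    and h: "h \<in># F" "infinite (nat_zeros h)" "\<not> (\<exists>l. int_linear l \<and> l dvd h)"
  shows "\<exists>h' a b. h' \<in># F \<and> infinite (nat_zeros h') \<and> \<not> (\<exists>l. int_linear l \<and> l dvd h') \<and>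
    lex_pos a b \<and> translates_into h a b h'"
proof -
  obtain D C where D: "finite D" "\<forall>(a, b) \<in> D. lex_pos a b"
    and step: "\<forall>(n, m) \<in> nat_zeros p. C \<le> n \<or> C \<le> m \<longrightarrow>
       (\<exists>(a, b) \<in> D. \<exists>(i, j) \<in> nat_zeros p. int i = int n + a \<and> int j = int m + b)"
    using rational_gen_fun_imp_successor[OF rat] by blast
  have zeros: "(n, m) \<in> nat_zeros p \<longleftrightarrow> (\<exists>h\<in>#F. (n, m) \<in> nat_zeros h)" for n m
    unfolding p by (induction F) (auto simp: nat_zeros_def)
  define A where "A = nat_zeros h - {..<C} \<times> {..<C}"
  have "infinite A" using h(2) by (auto simp: A_def)
  define R where "R = (\<lambda>(n, m) ((a, b), h' :: 'a poly poly).
    \<exists>(i, j) \<in> nat_zeros h'. int i = int n + a \<and> int j = int m + b)"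
  \<comment> \<open>Pigeonhole over pairs of a vector and a factor: one pair serves infinitely many
    zeros of \<open>h\<close>.\<close>
  have "\<exists>y \<in> D \<times> set_mset F. infinite {x \<in> A. R x y}"
  proof (intro pigeonhole_infinite_rel \<open>infinite A\<close> ballI)
    show "finite (D \<times> set_mset F)" using D by simp
    fix x assume x: "x \<in> A"
    obtain n m where nm: "x = (n, m)" by fastforce
    have "(n, m) \<in> nat_zeros p" "C \<le> n \<or> C \<le> m"
      using x nm h(1) zeros by (auto simp: A_def)
    then obtain a b i j where "(a, b) \<in> D" "(i, j) \<in> nat_zeros p" "int i = int n + a" "int j = int m + b"
      using step by fast
    moreover obtain h' where "h' \<in># F" "(i, j) \<in> nat_zeros h'"
      using \<open>(i, j) \<in> nat_zeros p\<close> zeros by auto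
    ultimately have "R x ((a, b), h')" "((a, b), h') \<in> D \<times> set_mset F"
      unfolding R_def nm by auto
    then show "\<exists>y \<in> D \<times> set_mset F. R x y" by blast
  qed
  then obtain a b h' where ab: "(a, b) \<in> D" and h': "h' \<in># F"
    and inf: "infinite {x \<in> A. R x ((a, b), h')}" (is "infinite ?X") by auto
  have X: "beval h (of_nat n) (of_nat m) = 0"
      "beval h' (of_nat n + of_int a) (of_nat m + of_int b) = 0"
      "int n + a \<ge> 0" "int m + b \<ge> 0" "(nat (int n + a), nat (int m + b)) \<in> nat_zeros h'"
    if x: "(n, m) \<in> ?X" for n m
  proof -
    show "beval h (of_nat n) (of_nat m) = 0" using x by (simp add: A_def nat_zeros_def)
    obtain i j where ij: "(i, j) \<in> nat_zeros h'" "int i = int n + a" "int j = int m + b"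
      using x by (auto simp: R_def)
    have "(of_nat i :: 'a) = of_nat n + of_int a" "(of_nat j :: 'a) = of_nat m + of_int b"
      using ij(2,3)[THEN arg_cong[of _ _ "of_int :: int \<Rightarrow> 'a"]] by simp_all
    then show "beval h' (of_nat n + of_int a) (of_nat m + of_int b) = 0"
      using ij(1) by (simp add: nat_zeros_def)
    show "int n + a \<ge> 0" "int m + b \<ge> 0" using ij by linarith+
    show "(nat (int n + a), nat (int m + b)) \<in> nat_zeros h'" using ij by (metis nat_int)
  qed
  \<comment> \<open>Applied twice: to \<open>h\<close> and the translate of \<open>h'\<close>, then
    to a translated line and \<open>h\<close>.\<close>
  have common: "q dvd w" if q: "irreducible q" and w: "\<And>n m. (n, m) \<in> ?X \<Longrightarrow>
      beval q (of_nat n) (of_nat m) = 0 \<and> beval w (of_nat n) (of_nat m) = 0" for q w :: "'a poly poly"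
  proof -
    have "?X \<subseteq> {(n, m). (n, m) \<in> nat_zeros q \<and> beval w (of_nat n) (of_nat m) = 0}"
      using w by (auto simp: nat_zeros_def)
    from infinite_super[OF this inf] show ?thesis
      by (intro irreducible_dvd_if_infinite_common_zeros[OF q] infinite_nat_zeros_imp_infinite_zeros)
  qed
  have "h dvd shift (of_int a) (of_int b) h'"
  proof (rule common)
    show "irreducible h" using irr h(1) by blast
  qed (use X(1,2) in \<open>simp_all add: beval_shift\<close>)
  then have tr: "translates_into h a b h'"
    unfolding translates_into_def beval_shift[symmetric] using beval_dvd by blast
  have "infinite (nat_zeros h')"
  proof
    assume fin: "finite (nat_zeros h')"
    \<comment> \<open>The translated coordinates are nonnegative on \<open>?X\<close>, so
      \<open>nat\<close> loses nothing and \<open>?f\<close> is injective there.\<close>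
    let ?f = "\<lambda>(n, m). (nat (int n + a), nat (int m + b))"
    have "inj_on ?f ?X"
    proof (rule inj_on_inverseI[where g = "\<lambda>(i, j). (nat (int i - a), nat (int j - b))"])
      fix x assume x: "x \<in> ?X"
      obtain n m where "x = (n, m)" by fastforce
      then show "(case ?f x of (i, j) \<Rightarrow> (nat (int i - a), nat (int j - b))) = x"
        using X(3,4)[of n m] x by simp
    qed
    moreover have "?f ` ?X \<subseteq> nat_zeros h'" using X(5) by auto
    ultimately show False using inf fin by (meson finite_imageD finite_subset)
  qed
  \<comment> \<open>By irreducibility of \<open>h'\<close>, such an \<open>l\<close> vanishes at all
    its zeros; so the translate \<open>l'\<close> vanishes on \<open>?X\<close> and divides
    \<open>h\<close>, which is excluded.\<close>
  moreover have "\<not> (\<exists>l. int_linear l \<and> l dvd h')"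
  proof safe
    fix l assume l: "int_linear l" "l dvd h'"
    obtain l' where l': "int_linear l'"
      "\<And>u v. beval l' u v = beval l (u + of_int a) (v + of_int b)"
      using int_linear_shift[OF l(1)] by blast
    have "\<not> is_unit l" using int_linear_irreducible[OF l(1)] irreducible_not_unit by blast
    have "l' dvd h"
    proof (rule common)
      show "irreducible l'" using l'(1) by (rule int_linear_irreducible)
      fix n m assume x: "(n, m) \<in> ?X"
      have "beval l (of_nat n + of_int a) (of_nat m + of_int b) = 0"
        using beval_eq_0_if_dvd_irreducible[OF irr[OF h'] l(2) \<open>\<not> is_unit l\<close> X(2)[OF x]] .
      then show "beval l' (of_nat n) (of_nat m) = 0 \<and> beval h (of_nat n) (of_nat m) = 0"
        using X(1)[OF x] l'(2) by simp
    qed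
    then show False using h(3) l'(1) by blast
  qed
  ultimately show ?thesis using h' ab D(2) tr by blast
qed

text \<open>On the finite set \<open>H\<close> of counterexamples, \<open>R\<close> is a strict
  order: transitive since lexicographically positive vectors add up, irreflexive since a
  self-translation produces an integer linear divisor. A maximal element would have no
  successor.\<close>

lemma finite_nat_zeros_factor:
  fixes p :: "'a::field_char_0 poly poly"
  assumes rat: "rational_fps2 (gen_fun p)" and p: "p = prod_mset F"
    and irr: "\<And>h. h \<in># F \<Longrightarrow> irreducible h"
    and h: "h \<in># F" "\<not> (\<exists>l. int_linear l \<and> l dvd h)"
  shows "finite (nat_zeros h)"
proof (rule ccontr)
  assume inf: "infinite (nat_zeros h)"
  define H where "H = {h. h \<in># F \<and> infinite (nat_zeros h) \<and> \<not> (\<exists>l. int_linear l \<and> l dvd h)}"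
  define R where "R h h' \<longleftrightarrow> (\<exists>a b. lex_pos a b \<and> translates_into h a b h')"
    for h h' :: "'a poly poly"
  have "finite H" by (rule finite_subset[of _ "set_mset F"]) (auto simp: H_def)
  have "H \<noteq> {}" using inf h by (auto simp: H_def)
  have trans: "R x z" if "R x y" "R y z" for x y z
    using that translates_into_trans lex_pos_add unfolding R_def by metis
  have irrefl: "\<not> R x x" if "x \<in> H" for x
  proof
    assume "R x x"
    then obtain a b where ab: "lex_pos a b" "translates_into x a b x" by (auto simp: R_def)
    have "nat_zeros x \<noteq> {}" using that by (auto simp: H_def)
    then obtain n m where "(n, m) \<in> nat_zeros x" by (metis all_not_in_conv surj_pair)
    then show False
      using self_translate_imp_int_linear_dvd[OF ab(2)] ab(1) that by (auto simp: H_def lex_pos_def)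
  qed
  have "asymp_on H R" "transp_on H R"
    using trans irrefl by (blast intro: asymp_onI transp_onI)+
  then obtain x where x: "x \<in> H" "\<And>y. y \<in> H \<Longrightarrow> y \<noteq> x \<Longrightarrow> \<not> R x y"
    using Finite_Set.bex_max_element[OF \<open>finite H\<close> _ _ \<open>H \<noteq> {}\<close>] by blast
  moreover obtain y where "y \<in> H" "R x y"
    using exists_successor_factor[OF rat p irr, of x] x(1) unfolding H_def R_def by blast
  ultimately show False using irrefl by metis
qed

section \<open>Assembling the factorization\<close>

text \<open>An irreducible factor with an integer linear divisor \<open>l\<close> is
  \<open>l\<close> times a unit, and the unit joins \<open>g\<close> without adding zeros; all other
  factors go into \<open>g\<close>.\<close>

lemma split_off_int_linear:
  fixes F :: "'a::field_char_0 poly poly multiset"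
  assumes "\<And>h. h \<in># F \<Longrightarrow> irreducible h"
    and "\<And>h. h \<in># F \<Longrightarrow> \<not> (\<exists>l. int_linear l \<and> l dvd h) \<Longrightarrow> finite (nat_zeros h)"
  shows "\<exists>ls g. prod_mset F = prod_list ls * g \<and> (\<forall>l \<in> set ls. int_linear l) \<and> finite (nat_zeros g)"
  using assms
proof (induction F)
  case empty
  show ?case by (intro exI[of _ "[]"] exI[of _ 1]) (simp add: nat_zeros_def)
next
  case (add h F)
  then obtain ls g where IH: "prod_mset F = prod_list ls * g" "\<forall>l \<in> set ls. int_linear l"
    "finite (nat_zeros g)" by (metis insert_iff set_mset_add_mset_insert)
  show ?case
  proof (cases "\<exists>l. int_linear l \<and> l dvd h")
    case True
    then obtain l k where l: "int_linear l" "h = l * k" by (auto elim!: dvdE)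
    have "is_unit k"
      using add.prems(1)[of h] l int_linear_irreducible irreducibleD irreducible_not_unit by fastforce
    then have "nat_zeros (k * g) = nat_zeros g"
      using is_unit_imp_beval_nonzero[of k] by (auto simp: nat_zeros_def)
    then show ?thesis
      using IH l by (intro exI[of _ "l # ls"] exI[of _ "k * g"]) (auto simp: algebra_simps)
  next
    case False
    have "nat_zeros (h * g) = nat_zeros h \<union> nat_zeros g" by (auto simp: nat_zeros_def)
    then show ?thesis
      using IH False add.prems(2)[of h]
      by (intro exI[of _ ls] exI[of _ "h * g"]) (auto simp: algebra_simps)
  qed
qed

theorem theorem4p4:
  fixes p :: "'a::field_char_0 poly poly"
  assumes "p \<noteq> 0"
    and "rational_fps2 (gen_fun p)"
  shows "\<exists>(c :: 'a) (f :: 'a poly poly) (g :: 'a poly poly) (ls :: 'a poly poly list).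
           p = bconst c * f * g \<and>
           f = prod_list ls \<and> (\<forall>l \<in> set ls. int_linear l) \<and>
           finite (nat_zeros g)"
proof -
  have one: "bconst 1 = (1 :: 'a poly poly)" by (metis bconst_def one_pCons)
  have "\<exists>ls g. p = prod_list ls * g \<and> (\<forall>l \<in> set ls. int_linear l) \<and> finite (nat_zeros g)"
  proof (cases "is_unit p")
    \<comment> \<open>A unit is not a nonempty product of irreducibles; having no zeros, it serves
      as \<open>g\<close>.\<close>
    case True
    then have "nat_zeros p = {}" using is_unit_imp_beval_nonzero by (auto simp: nat_zeros_def)
    then show ?thesis by (intro exI[of _ "[]"] exI[of _ p]) simp
  next
    case False
    then obtain F where F: "\<And>h. h \<in># F \<Longrightarrow> irreducible h" "p = prod_mset F"
      using mset_factors_exist assms(1) by (metis mset_factors_def)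
    show ?thesis
      unfolding F(2) by (intro split_off_int_linear F(1) finite_nat_zeros_factor[OF assms(2) F(2)])
  qed
  then obtain ls g where "p = prod_list ls * g" "\<forall>l \<in> set ls. int_linear l" "finite (nat_zeros g)"
    by blast
  then show ?thesis
    \<comment> \<open>Scalars are already absorbed in \<open>g\<close>, so the constant is
      1.\<close>
    by (intro exI[of _ 1] exI[of _ "prod_list ls"] exI[of _ g] exI[of _ ls]) (simp add: one)
qed

end
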